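(* Let $\alpha\in(0,2]$ and $c>0$, and for $x\in(0,\pi)$ let $$G_{\alpha,c}(x)\;=\;\frac{1}{2\pi}\sum_{n\in\mathbb{Z}}\frac{\cos(nx)}{c+|n|^\alpha}.$$ Then $G_{\alpha,c}'(\pi-)=0$, that is, $\lim_{x\uparrow\pi}G_{\alpha,c}'(x)=0$. Moreover, there does not exist any positive Radon measure $\mu$ on $[0,\infty)$ such that $$G_{\alpha,c}(x)\;=\;\int_0^\infty e^{-xt}\,d\mu(t)\qquad\text{for all } x\in(0,\pi),$$ and $G_{\alpha,c}$ cannot be extended from $(0,\pi)$ to a completely monotone function on the whole half-line $(0,\infty)$.
   Context: For $x\in(0,\pi)$ the series is understood as the limit of the symmetric partial sums $\frac{1}{2\pi}\sum_{|n|\le N}\frac{\cos(nx)}{c+|n|^\alpha}$ as $N\to\infty$ (the convergence is only conditional for $\alpha\le 1$); here $|0|^\alpha=0$. The function $G_{\alpha,c}$ is the Green function of the operator $c+(-\Delta)^{\alpha/2}$ on the periodic domain $[-\pi,\pi]$. A function $f$ on an open interval $I\subset\mathbb{R}$ is called completely monotone on $I$ if it is infinitely differentiable on $I$ and $(-1)^p f^{(p)}(x)\ge 0$ for every $x\in I$ and every integer $p\ge 0$. *)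

theory Defs
  imports "HOL-Analysis.Analysis"
begin

text \<open>
  In the term \<open>n = 0\<close> the convention \<open>0 powr \<alpha> = 0\<close> of the library gives
  the value \<open>1 / c\<close>.
\<close>

definition green_partial_sum :: "real \<Rightarrow> real \<Rightarrow> nat \<Rightarrow> real \<Rightarrow> real" where
  "green_partial_sum \<alpha> c N x =
     1 / (2 * pi) *
       (\<Sum>n\<in>{- int N..int N}. cos (real_of_int n * x) / (c + \<bar>real_of_int n\<bar> powr \<alpha>))"

definition green :: "real \<Rightarrow> real \<Rightarrow> real \<Rightarrow> real" where
  "green \<alpha> c x = lim (\<lambda>N. green_partial_sum \<alpha> c N x)"

text \<open>
  Intended for open \<open>I\<close>: there the iterated derivatives depend only on the
  values of \<open>f\<close> on \<open>I\<close>. Differentiability of every iterate is required explicitly because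
  \<open>deriv\<close> is a total function.
\<close>

definition completely_monotone_on :: "real set \<Rightarrow> (real \<Rightarrow> real) \<Rightarrow> bool" where
  "completely_monotone_on I f \<longleftrightarrow>
     (\<forall>p. \<forall>x\<in>I. (deriv ^^ p) f differentiable at x) \<and>
     (\<forall>p. \<forall>x\<in>I. (- 1) ^ p * (deriv ^^ p) f x \<ge> 0)"

text \<open>
  A positive Radon measure on \<open>S\<close> is a Borel measure on the subspace \<open>S\<close> that is finite on
  compact sets. Inner and outer regularity are not demanded: on a closed subset of the real
  line they follow from finiteness on compact sets.
\<close>

definition radon_measure_on :: "real set \<Rightarrow> real measure \<Rightarrow> bool" where
  "radon_measure_on S \<mu> \<longleftrightarrow>
     sets \<mu> = sets (restrict_space borel S) \<and>
     (\<forall>K. compact K \<and> K \<subseteq> S \<longrightarrow> emeasure \<mu> K < \<infinity>)"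

end

theory Submission
  imports Defs
begin

text \<open>
  Multiplying the Fourier series by \<open>2 cos x - 2\<close> replaces the coefficients by their second
  differences, which are \<open>O(n powr (- \<alpha> - 2))\<close>. Hence \<open>G\<close> is \<open>C\<^sup>1\<close> on \<open>(0, 2\<pi>)\<close>, and \<open>G'(\<pi>) = 0\<close>
  because \<open>sin (n\<pi>) = 0\<close>. A Laplace transform or a completely monotone function with vanishing
  derivative at \<open>\<pi>\<close> is constant, whereas a constant \<open>G\<close> would have affine, hence
  vanishing, Fourier coefficients.
\<close>

section \<open>Second differences\<close>

text \<open>The mean value theorem, applied first to \<open>f (y + 1) - f y\<close> and then to
  \<open>f'\<close>, turns the second difference into \<open>f'' w\<close> for some
  \<open>w > x\<close>. Since \<open>s \<ge> 0\<close>, the bound at \<open>w\<close> is at most the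
  bound at \<open>x\<close>.\<close>

lemma second_difference_bound:
  fixes f f' f'' :: "real \<Rightarrow> real"
  assumes f': "\<And>y. 0 < y \<Longrightarrow> (f has_field_derivative f' y) (at y)"
    and f'': "\<And>y. 0 < y \<Longrightarrow> (f' has_field_derivative f'' y) (at y)"
    and bound: "\<And>y. 0 < y \<Longrightarrow> \<bar>f'' y\<bar> \<le> C * y powr (- s)"
    and "0 \<le> s" "0 < x"
  shows "\<bar>f (x + 2) - 2 * f (x + 1) + f x\<bar> \<le> C * x powr (- s)"
proof -
  have C: "0 \<le> C"
    using bound[of 1] by simp
  have "\<exists>z. x < z \<and> z < x + 1 \<and>
      (f (x + 1 + 1) - f (x + 1)) - (f (x + 1) - f x) = (x + 1 - x) * (f' (z + 1) - f' z)"
    using \<open>0 < x\<close>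
    by (intro MVT2[where f = "\<lambda>y. f (y + 1) - f y"])
      (auto intro!: derivative_eq_intros DERIV_chain2[OF f'] f')
  then obtain z where z: "x < z"
    "(f (x + 1 + 1) - f (x + 1)) - (f (x + 1) - f x) = f' (z + 1) - f' z"
    by auto
  have "\<exists>w. z < w \<and> w < z + 1 \<and> f' (z + 1) - f' z = (z + 1 - z) * f'' w"
    using z(1) \<open>0 < x\<close> by (intro MVT2 f'') auto
  then obtain w where w: "z < w" "f' (z + 1) - f' z = f'' w"
    by auto
  have "f (x + 2) - 2 * f (x + 1) + f x = f'' w"
    using z(2) w(2) by (simp add: add.assoc)
  also have "\<bar>f'' w\<bar> \<le> C * w powr (- s)"
    using z(1) w(1) \<open>0 < x\<close> by (intro bound) auto
  also have "\<dots> \<le> C * x powr (- s)"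
    using z(1) w(1) \<open>0 < x\<close> \<open>0 \<le> s\<close> C by (intro mult_left_mono powr_mono2') auto
  finally show ?thesis .
qed

text \<open>The expression is the second derivative of \<open>1 / (c + x powr \<alpha>)\<close>.
  With \<open>p = x powr \<alpha>\<close>, the inequality \<open>c + p \<ge> p\<close> bounds each
  term by a constant times \<open>1 / (p * x\<^sup>2)\<close>.\<close>

lemma symbol_second_derivative_bound:
  fixes \<alpha> c x :: real
  assumes "0 < \<alpha>" "0 < c" "0 < x"
  shows "\<bar>2 * \<alpha>\<^sup>2 * (x powr (\<alpha> - 1))\<^sup>2 / (c + x powr \<alpha>) ^ 3
           - \<alpha> * (\<alpha> - 1) * x powr (\<alpha> - 2) / (c + x powr \<alpha>)\<^sup>2\<bar>
         \<le> (\<alpha> * \<bar>\<alpha> - 1\<bar> + 2 * \<alpha>\<^sup>2) * x powr (- (\<alpha> + 2))"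
proof -
  define p where "p = x powr \<alpha>"
  have p: "0 < p"
    using assms by (simp add: p_def)
  have eqs: "x powr (\<alpha> - 1) = p / x" "x powr (\<alpha> - 2) = p / x\<^sup>2" "x powr (- (\<alpha> + 2)) = 1 / (p * x\<^sup>2)"
    using assms by (simp_all add: p_def powr_diff powr_add powr_minus divide_simps)
  have b2: "p / (c + p)\<^sup>2 \<le> 1 / p"
  proof -
    have "p / (c + p)\<^sup>2 \<le> p / p\<^sup>2"
      using p assms by (intro divide_left_mono power_mono) auto
    then show ?thesis
      using p by (simp add: power2_eq_square)
  qed
  have b3: "p\<^sup>2 / (c + p) ^ 3 \<le> 1 / p"
  proof -
    have "p\<^sup>2 / (c + p) ^ 3 \<le> p\<^sup>2 / p ^ 3"
      using p assms by (intro divide_left_mono power_mono) auto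
    then show ?thesis
      using p by (simp add: power2_eq_square power3_eq_cube)
  qed
  have "\<bar>2 * \<alpha>\<^sup>2 * (p / x)\<^sup>2 / (c + p) ^ 3 - \<alpha> * (\<alpha> - 1) * (p / x\<^sup>2) / (c + p)\<^sup>2\<bar>
      = \<bar>2 * \<alpha>\<^sup>2 * (p\<^sup>2 / (c + p) ^ 3) / x\<^sup>2 - \<alpha> * (\<alpha> - 1) * (p / (c + p)\<^sup>2) / x\<^sup>2\<bar>"
    by (simp add: power_divide mult_ac)
  also have "\<dots> \<le> \<bar>2 * \<alpha>\<^sup>2 * (p\<^sup>2 / (c + p) ^ 3) / x\<^sup>2\<bar> + \<bar>\<alpha> * (\<alpha> - 1) * (p / (c + p)\<^sup>2) / x\<^sup>2\<bar>"
    by (rule abs_triangle_ineq4)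
  also have "\<dots> = 2 * \<alpha>\<^sup>2 * (p\<^sup>2 / (c + p) ^ 3) / x\<^sup>2 + \<alpha> * \<bar>\<alpha> - 1\<bar> * (p / (c + p)\<^sup>2) / x\<^sup>2"
    using assms p by (simp add: abs_mult)
  also have "\<dots> \<le> 2 * \<alpha>\<^sup>2 * (1 / p) / x\<^sup>2 + \<alpha> * \<bar>\<alpha> - 1\<bar> * (1 / p) / x\<^sup>2"
    using assms by (intro add_mono divide_right_mono mult_left_mono b2 b3) auto
  also have "\<dots> = (\<alpha> * \<bar>\<alpha> - 1\<bar> + 2 * \<alpha>\<^sup>2) * (1 / (p * x\<^sup>2))"
    by (simp add: add_divide_distrib distrib_right)
  finally show ?thesis
    unfolding eqs p_def[symmetric] .
qed

text \<open>The weight \<open>Suc n\<close> is the factor that differentiating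
  \<open>cos (Suc n * x)\<close> produces. It costs one power of \<open>n\<close>, and the remaining
  exponent \<open>- (\<alpha> + 1)\<close> is still summable.\<close>

lemma summable_symbol_second_difference:
  fixes \<alpha> c :: real
  defines "a \<equiv> \<lambda>n::nat. 1 / (c + real n powr \<alpha>)"
  assumes "0 < \<alpha>" "0 < c"
  shows "summable (\<lambda>n. real (Suc n) * \<bar>a (n + 2) - 2 * a (n + 1) + a n\<bar>)"
proof -
  define C where "C = \<alpha> * \<bar>\<alpha> - 1\<bar> + 2 * \<alpha>\<^sup>2"
  have C: "0 \<le> C"
    using assms by (simp add: C_def)
  have pos: "c + x powr \<alpha> > 0" for x :: real
    using \<open>0 < c\<close> by (simp add: add_pos_nonneg)
  have bound: "\<bar>a (n + 2) - 2 * a (n + 1) + a n\<bar> \<le> C * real n powr (- (\<alpha> + 2))" if "n > 0" for n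
  proof -
    have "\<bar>1 / (c + (real n + 2) powr \<alpha>) - 2 * (1 / (c + (real n + 1) powr \<alpha>)) + 1 / (c + real n powr \<alpha>)\<bar>
        \<le> C * real n powr (- (\<alpha> + 2))"
    proof (rule second_difference_bound)
      fix y :: real
      assume y: "0 < y"
      show "((\<lambda>y. 1 / (c + y powr \<alpha>)) has_field_derivative
          - (\<alpha> * y powr (\<alpha> - 1)) / (c + y powr \<alpha>)\<^sup>2) (at y)"
        using y pos[of y] by (auto intro!: derivative_eq_intros simp: power2_eq_square)
      show "((\<lambda>y. - (\<alpha> * y powr (\<alpha> - 1)) / (c + y powr \<alpha>)\<^sup>2) has_field_derivative
          2 * \<alpha>\<^sup>2 * (y powr (\<alpha> - 1))\<^sup>2 / (c + y powr \<alpha>) ^ 3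
           - \<alpha> * (\<alpha> - 1) * y powr (\<alpha> - 2) / (c + y powr \<alpha>)\<^sup>2) (at y)"
        using y pos[of y]
        by (auto intro!: derivative_eq_intros simp: divide_simps) algebra
      show "\<bar>2 * \<alpha>\<^sup>2 * (y powr (\<alpha> - 1))\<^sup>2 / (c + y powr \<alpha>) ^ 3
           - \<alpha> * (\<alpha> - 1) * y powr (\<alpha> - 2) / (c + y powr \<alpha>)\<^sup>2\<bar> \<le> C * y powr (- (\<alpha> + 2))"
        unfolding C_def using assms y by (intro symbol_second_derivative_bound)
    qed (use assms that in auto)
    then show ?thesis
      by (simp add: a_def add.commute)
  qed
  show ?thesis
  proof (rule summable_comparison_test_ev)
    show "summable (\<lambda>n. 2 * C * real n powr (- (\<alpha> + 1)))"
      using assms by (intro summable_mult) (simp add: summable_real_powr_iff)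
    show "\<forall>\<^sub>F n in sequentially. norm (real (Suc n) * \<bar>a (n + 2) - 2 * a (n + 1) + a n\<bar>)
        \<le> 2 * C * real n powr (- (\<alpha> + 1))"
      \<comment> \<open>The comparison starts at \<open>n = 1\<close>, because at \<open>0\<close>
        the right-hand side is \<open>0\<close>. For \<open>n > 0\<close>,
        \<open>Suc n \<le> 2 * n\<close> gives the factor \<open>2\<close>.\<close>
      using eventually_gt_at_top[of 0]
    proof eventually_elim
      case (elim n)
      have "real (Suc n) * \<bar>a (n + 2) - 2 * a (n + 1) + a n\<bar> \<le> (2 * real n) * (C * real n powr (- (\<alpha> + 2)))"
        using elim by (intro mult_mono bound) auto
      also have "real n powr (- (\<alpha> + 1)) = real n * real n powr (- (\<alpha> + 2))"
        using elim by (simp add: powr_mult_base algebra_simps)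
      then have "(2 * real n) * (C * real n powr (- (\<alpha> + 2))) = 2 * C * real n powr (- (\<alpha> + 1))"
        by simp
      finally show ?case
        by simp
    qed
  qed
qed

section \<open>Cosine series\<close>

text \<open>The factor \<open>2 * cos x\<close> shifts frequencies by one in both directions, so
  second differences of the even extension of \<open>a\<close> appear. At frequency \<open>0\<close>
  this second difference is \<open>2 * (a 1 - a 0)\<close>; the last summand collects the boundary
  terms.\<close>

lemma summation_by_parts_cos:
  fixes a :: "nat \<Rightarrow> real"
  shows "(2 * cos x - 2) * (a 0 + 2 * (\<Sum>n<N. a (Suc n) * cos (real (Suc n) * x))) =
    2 * (a 1 - a 0) + 2 * (\<Sum>n<N. (a (n + 2) - 2 * a (n + 1) + a n) * cos (real (Suc n) * x))
    + 2 * (a N * cos (real (Suc N) * x) - a (Suc N) * cos (real N * x))"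
proof (induction N)
  case 0
  then show ?case
    by (simp add: algebra_simps)
next
  case (Suc N)
  have "cos (real (Suc (Suc N)) * x) + cos (real N * x) = 2 * cos x * cos (real (Suc N) * x)"
    by (simp add: cos_plus_cos algebra_simps add_divide_distrib)
  then have r: "cos (real (Suc (Suc N)) * x) = 2 * cos x * cos (real (Suc N) * x) - cos (real N * x)"
    by simp
  have "(2 * cos x - 2) * (a 0 + 2 * (\<Sum>n<Suc N. a (Suc n) * cos (real (Suc n) * x))) =
     (2 * cos x - 2) * (a 0 + 2 * (\<Sum>n<N. a (Suc n) * cos (real (Suc n) * x)))
     + (2 * cos x - 2) * (2 * a (Suc N) * cos (real (Suc N) * x))"
    by (simp add: algebra_simps)
  then show ?case
    unfolding Suc.IH r by (simp add: algebra_simps)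
qed

lemma uniform_limit_trig_series:
  fixes e :: "nat \<Rightarrow> real" and g :: "real \<Rightarrow> real"
  assumes "summable (\<lambda>n. \<bar>e n\<bar>)" "\<And>y. \<bar>g y\<bar> \<le> 1"
  shows "uniform_limit S (\<lambda>N x. \<Sum>n<N. e n * g (real (Suc n) * x))
    (\<lambda>x. \<Sum>n. e n * g (real (Suc n) * x)) sequentially"
  by (rule Weierstrass_m_test[OF _ assms(1)]) (simp add: abs_mult mult_left_le assms(2))

lemma summable_of_summable_Suc_mult:
  fixes e :: "nat \<Rightarrow> real"
  assumes "summable (\<lambda>n. real (Suc n) * \<bar>e n\<bar>)"
  shows "summable (\<lambda>n. \<bar>e n\<bar>)"
  by (rule summable_comparison_test'[OF assms]) (simp add: algebra_simps)

text \<open>The weighted summability makes the differentiated series converge uniformly on the whole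
  line, and the series itself converges at the base point \<open>0\<close>; this justifies termwise
  differentiation.\<close>

lemma has_field_derivative_cos_series:
  fixes e :: "nat \<Rightarrow> real"
  assumes sm: "summable (\<lambda>n. real (Suc n) * \<bar>e n\<bar>)"
  shows "((\<lambda>x. \<Sum>n. e n * cos (real (Suc n) * x)) has_field_derivative
    (\<Sum>n. - (real (Suc n) * e n) * sin (real (Suc n) * x))) (at x)"
proof (rule has_field_derivative_series'(2))
  have "uniform_limit UNIV (\<lambda>N x. \<Sum>n<N. - (real (Suc n) * e n) * sin (real (Suc n) * x))
    (\<lambda>x. \<Sum>n. - (real (Suc n) * e n) * sin (real (Suc n) * x)) sequentially"
    by (rule uniform_limit_trig_series) (use sm in \<open>simp_all add: abs_mult\<close>)
  then show "uniformly_convergent_on UNIV (\<lambda>N x. \<Sum>n<N. - (real (Suc n) * e n) * sin (real (Suc n) * x))"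
    by (rule uniformly_convergentI)
  show "((\<lambda>x. e n * cos (real (Suc n) * x)) has_field_derivative
      - (real (Suc n) * e n) * sin (real (Suc n) * x)) (at x within UNIV)" for n x
    by (auto intro!: derivative_eq_intros)
  show "summable (\<lambda>n. e n * cos (real (Suc n) * 0))"
    using summable_of_summable_Suc_mult[OF sm] by (simp add: summable_rabs_cancel)
qed auto

lemma continuous_sin_series:
  fixes e :: "nat \<Rightarrow> real"
  assumes "summable (\<lambda>n. \<bar>e n\<bar>)"
  shows "continuous_on UNIV (\<lambda>x. \<Sum>n. e n * sin (real (Suc n) * x))"
  by (rule uniform_limit_theorem[OF _ uniform_limit_trig_series[OF assms]])
    (auto intro!: always_eventually continuous_intros)

section \<open>Orthogonality of cosines and recovery of Fourier coefficients\<close>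

lemma has_integral_cos_multiple:
  assumes "k \<noteq> 0"
  shows "((\<lambda>x. cos (of_int k * x)) has_integral 0) {0..pi}"
proof -
  have "((\<lambda>x. cos (of_int k * x)) has_integral
      (sin (of_int k * pi) / of_int k - sin (of_int k * 0) / of_int k)) {0..pi}"
    using assms
    by (intro fundamental_theorem_of_calculus)
      (auto intro!: derivative_eq_intros simp: has_real_derivative_iff_has_vector_derivative[symmetric])
  then show ?thesis
    by (simp add: mult.commute sin_int_times_real)
qed

text \<open>Product-to-sum leaves the frequencies \<open>n - m\<close> and \<open>n + m\<close>.
  Because \<open>0 < m\<close>, the second is never \<open>0\<close>, so the diagonal value is
  \<open>pi / 2\<close>.\<close>

lemma has_integral_cos_mult_cos:
  fixes m n :: nat
  assumes "0 < m"
  shows "((\<lambda>x. cos (real n * x) * cos (real m * x)) has_integral (if n = m then pi / 2 else 0)) {0..pi}"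
proof -
  have eq: "cos (real n * x) * cos (real m * x) =
      (cos (of_int (int n - int m) * x) + cos (of_int (int n + int m) * x)) / 2" for x
    by (simp add: cos_diff cos_add left_diff_distrib distrib_right)
  have d: "((\<lambda>x. cos (of_int (int n - int m) * x)) has_integral (if n = m then pi else 0)) {0..pi}"
    using has_integral_cos_multiple[of "int n - int m"] has_integral_const_real[of "1::real" 0 pi]
    by (cases "n = m") auto
  have s: "((\<lambda>x. cos (of_int (int n + int m) * x)) has_integral 0) {0..pi}"
    using assms by (intro has_integral_cos_multiple) auto
  show ?thesis
    unfolding eq using has_integral_divide[OF has_integral_add[OF d s], of 2] by (simp split: if_splits)
qed

text \<open>Uniform convergence allows termwise integration. Frequency \<open>m\<close> has index
  \<open>m - 1\<close>, as the series starts at frequency \<open>1\<close>; once that index is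
  included, the integrals of the partial sums no longer change.\<close>

lemma cos_series_coefficients:
  fixes e :: "nat \<Rightarrow> real"
  assumes sm: "summable (\<lambda>n. \<bar>e n\<bar>)" and "0 < m"
  shows "((\<lambda>x. (\<Sum>n. e n * cos (real (Suc n) * x)) * cos (real m * x)) has_integral
     e (m - 1) * (pi / 2)) {0..pi}"
proof -
  let ?f = "\<lambda>n x. e n * (cos (real (Suc n) * x) * cos (real m * x))"
  let ?K = "\<lambda>x. \<Sum>n. e n * cos (real (Suc n) * x)"
  have "uniform_limit {0..pi} (\<lambda>N x. \<Sum>n<N. ?f n x) (\<lambda>x. \<Sum>n. ?f n x) sequentially"
    by (rule Weierstrass_m_test[OF _ sm]) (simp add: abs_mult mult_left_le mult_le_one)
  then obtain I J where I: "\<And>N. ((\<lambda>x. \<Sum>n<N. ?f n x) has_integral I N) {0..pi}"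
    and J: "((\<lambda>x. \<Sum>n. ?f n x) has_integral J) {0..pi}" and lim: "I \<longlonglongrightarrow> J"
    by (rule uniform_limit_integral) (auto intro!: continuous_intros)
  have "I N = e (m - 1) * (pi / 2)" if "m \<le> N" for N
  proof -
    have "((\<lambda>x. \<Sum>n<N. ?f n x) has_integral
        (\<Sum>n<N. e n * (if Suc n = m then pi / 2 else 0))) {0..pi}"
      by (intro has_integral_sum has_integral_mult_right has_integral_cos_mult_cos \<open>0 < m\<close>) simp
    then have "I N = (\<Sum>n<N. e n * (if Suc n = m then pi / 2 else 0))"
      using I has_integral_unique by blast
    also have "\<dots> = (\<Sum>n<N. if n = m - 1 then e n * (pi / 2) else 0)"
      using \<open>0 < m\<close> by (intro sum.cong) auto
    also have "\<dots> = e (m - 1) * (pi / 2)"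
      using that \<open>0 < m\<close> by simp
    finally show ?thesis .
  qed
  then have "I \<longlonglongrightarrow> e (m - 1) * (pi / 2)"
    by (intro tendsto_eventually eventually_sequentiallyI[of m])
  then have J_eq: "J = e (m - 1) * (pi / 2)"
    using lim LIMSEQ_unique by blast
  have "(\<Sum>n. ?f n x) = ?K x * cos (real m * x)" for x
  proof -
    have "summable (\<lambda>n. e n * cos (real (Suc n) * x))"
      by (rule summable_comparison_test'[OF sm, of 0]) (simp add: abs_mult mult_left_le)
    from suminf_mult2[OF this, of "cos (real m * x)"] show ?thesis
      by (simp add: mult.assoc)
  qed
  then show ?thesis
    using J J_eq by simp
qed

text \<open>For \<open>0 < m\<close> the coefficient \<open>e m\<close> belongs to a frequency at
  least \<open>2\<close>, which is orthogonal to both \<open>1\<close> and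
  \<open>cos x\<close>.\<close>

lemma cos_series_eq_affine_cos_imp:
  fixes e :: "nat \<Rightarrow> real"
  assumes sm: "summable (\<lambda>n. \<bar>e n\<bar>)"
    and eq: "\<And>x. 0 < x \<Longrightarrow> x < pi \<Longrightarrow> (\<Sum>n. e n * cos (real (Suc n) * x)) = A * cos x + B"
    and "0 < m"
  shows "e m = 0"
proof -
  have "((\<lambda>x. (\<Sum>n. e n * cos (real (Suc n) * x)) * cos (real (Suc m) * x)) has_integral
     e m * (pi / 2)) {0..pi}"
    using cos_series_coefficients[OF sm, of "Suc m"] by simp
  \<comment> \<open>The identity is given only on the open interval; the two endpoints form a
    negligible set.\<close>
  then have 1: "((\<lambda>x. (A * cos x + B) * cos (real (Suc m) * x)) has_integral e m * (pi / 2)) {0..pi}"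
    by (rule has_integral_spike_finite[of "{0, pi}", rotated 2]) (simp, subst eq, auto)
  have "((\<lambda>x. A * (cos (real 1 * x) * cos (real (Suc m) * x)) + B * (cos (real 0 * x) * cos (real (Suc m) * x)))
     has_integral (A * (if 1 = Suc m then pi / 2 else 0) + B * (if 0 = Suc m then pi / 2 else 0))) {0..pi}"
    by (intro has_integral_add has_integral_mult_right has_integral_cos_mult_cos) auto
  then have "((\<lambda>x. (A * cos x + B) * cos (real (Suc m) * x)) has_integral 0) {0..pi}"
    using \<open>0 < m\<close> by (simp add: algebra_simps)
  with 1 have "e m * (pi / 2) = 0"
    using has_integral_unique by blast
  then show ?thesis
    by simp
qed

text \<open>From index \<open>1\<close> on the sequence is affine, and a limit \<open>0\<close>
  forces first its slope and then its value to vanish. Index \<open>0\<close> is exempt, matching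
  the frequencies left undetermined by \<open>cos_series_eq_affine_cos_imp\<close>.\<close>

lemma eventually_affine_null_sequence:
  fixes a :: "nat \<Rightarrow> real"
  assumes lim: "a \<longlonglongrightarrow> 0"
    and aff: "\<And>n. 0 < n \<Longrightarrow> a (n + 2) - 2 * a (n + 1) + a n = 0"
  shows "a 1 = 0"
proof -
  have step: "a (Suc (Suc n)) - a (Suc n) = a 2 - a 1" for n
  proof (induction n)
    case 0
    then show ?case
      by (simp add: numeral_2_eq_2)
  next
    case (Suc n)
    then show ?case
      using aff[of "Suc n"] by simp
  qed
  have "(\<lambda>n. a (Suc (Suc n)) - a (Suc n)) \<longlonglongrightarrow> 0 - 0"
    by (intro tendsto_diff LIMSEQ_Suc lim)
  then have "a 2 - a 1 = 0"
    unfolding step by (simp add: LIMSEQ_const_iff)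
  then have "a (Suc n) = a 1" for n
    using step by (induction n) (auto simp: eq_diff_eq)
  then show ?thesis
    using LIMSEQ_Suc[OF lim] LIMSEQ_const_iff[of "a 1" 0] by presburger
qed

text \<open>Dividing the summation by parts by \<open>2 * cos x - 2\<close> leaves an absolutely
  convergent series and boundary terms that vanish with \<open>a\<close>. This covers sequences
  \<open>a\<close> that are not summable themselves.\<close>

lemma cos_sum_tendsto:
  fixes a :: "nat \<Rightarrow> real"
  defines "e \<equiv> \<lambda>n. a (n + 2) - 2 * a (n + 1) + a n"
  assumes lim: "a \<longlonglongrightarrow> 0" and sm: "summable (\<lambda>n. \<bar>e n\<bar>)" and x: "cos x \<noteq> 1"
  shows "(\<lambda>N. a 0 + 2 * (\<Sum>n<N. a (Suc n) * cos (real (Suc n) * x)))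
     \<longlonglongrightarrow> (a 1 - a 0 + (\<Sum>n. e n * cos (real (Suc n) * x))) / (cos x - 1)"
proof -
  have "summable (\<lambda>n. e n * cos (real (Suc n) * x))"
    by (rule summable_comparison_test'[OF sm, of 0]) (simp add: abs_mult mult_left_le)
  then have s: "(\<lambda>N. \<Sum>n<N. e n * cos (real (Suc n) * x)) \<longlonglongrightarrow> (\<Sum>n. e n * cos (real (Suc n) * x))"
    by (rule summable_LIMSEQ)
  have z: "(\<lambda>N. b N * cos (g N)) \<longlonglongrightarrow> 0" if "b \<longlonglongrightarrow> 0" for b g :: "nat \<Rightarrow> real"
    by (rule Lim_null_comparison[OF _ tendsto_rabs_zero[OF that]])
      (simp add: abs_mult mult_left_le)
  have "(\<lambda>N. (2 * (a 1 - a 0) + 2 * (\<Sum>n<N. e n * cos (real (Suc n) * x))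
      + 2 * (a N * cos (real (Suc N) * x) - a (Suc N) * cos (real N * x))) / (2 * cos x - 2))
    \<longlonglongrightarrow> (2 * (a 1 - a 0) + 2 * (\<Sum>n. e n * cos (real (Suc n) * x)) + 2 * (0 - 0)) / (2 * cos x - 2)"
    using x by (intro tendsto_intros s z lim LIMSEQ_Suc[OF lim]) auto
  moreover have "(2 * (a 1 - a 0) + 2 * (\<Sum>n<N. e n * cos (real (Suc n) * x))
      + 2 * (a N * cos (real (Suc N) * x) - a (Suc N) * cos (real N * x))) / (2 * cos x - 2)
     = a 0 + 2 * (\<Sum>n<N. a (Suc n) * cos (real (Suc n) * x))" for N
    using summation_by_parts_cos[of x a N, symmetric] x by (simp add: e_def)
  moreover have "(2 * (a 1 - a 0) + 2 * (\<Sum>n. e n * cos (real (Suc n) * x)) + 2 * (0 - 0)) / (2 * cos x - 2)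
     = (a 1 - a 0 + (\<Sum>n. e n * cos (real (Suc n) * x))) / (cos x - 1)"
    using x by (simp add: divide_simps) (simp add: algebra_simps)
  ultimately show ?thesis
    by simp
qed

section \<open>Completely monotone functions\<close>

text \<open>In the Taylor expansion at \<open>t\<close>, evaluated at \<open>t - r\<close>, the sign
  of \<open>D m\<close> cancels the sign of \<open>(- r) ^ m\<close>. All terms and the remainder
  are nonnegative, so each single term is at most \<open>D 0 (t - r)\<close>.\<close>

lemma completely_monotone_derivative_bound:
  fixes D :: "nat \<Rightarrow> real \<Rightarrow> real"
  assumes D: "\<And>p x. 0 < x \<Longrightarrow> (D p has_field_derivative D (Suc p) x) (at x)"
    and sign: "\<And>p x. 0 < x \<Longrightarrow> 0 \<le> (- 1) ^ p * D p x"
    and "0 < r" "r < t"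
  shows "(- 1) ^ p * D p t * r ^ p / fact p \<le> D 0 (t - r)"
proof -
  let ?T = "\<lambda>m s. D m s / fact m * (t - r - t) ^ m"
  have T: "?T m s = ((- 1) ^ m * D m s) * r ^ m / fact m" for m s
  proof -
    have "t - r - t = - r"
      by simp
    then show ?thesis
      using power_minus[of r m] by (simp only: times_divide_eq_left times_divide_eq_right mult_ac)
  qed
  have T_nonneg: "0 \<le> ?T m s" if "0 < s" for m s
    unfolding T using \<open>0 < r\<close> by (intro divide_nonneg_pos mult_nonneg_nonneg[OF sign[OF that]]) auto
  have "\<exists>s. t - r < s \<and> s < t \<and> D 0 (t - r) = (\<Sum>m<Suc p. ?T m t) + ?T (Suc p) s"
    using \<open>0 < r\<close> \<open>r < t\<close> by (intro Taylor_down[where b = t]) (auto intro: D)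
  then obtain s where s: "t - r < s" "D 0 (t - r) = (\<Sum>m<p. ?T m t) + ?T p t + ?T (Suc p) s"
    unfolding sum.lessThan_Suc by blast
  have "0 \<le> (\<Sum>m<p. ?T m t)"
    using \<open>0 < r\<close> \<open>r < t\<close> by (intro sum_nonneg T_nonneg) auto
  moreover have "0 \<le> ?T (Suc p) s"
    using s(1) \<open>r < t\<close> by (intro T_nonneg) auto
  ultimately have "?T p t \<le> D 0 (t - r)"
    unfolding s(2) by linarith
  then show ?thesis
    unfolding T .
qed

text \<open>
  By the derivative bound the Taylor series at a point \<open>z\<close> converges to the function on
  \<open>(2z/3, z]\<close>, so a zero half-line can be enlarged by a fixed factor.
\<close>

lemma completely_monotone_zero_extends_left:
  fixes D :: "nat \<Rightarrow> real \<Rightarrow> real"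
  assumes D: "\<And>p x. 0 < x \<Longrightarrow> (D p has_field_derivative D (Suc p) x) (at x)"
    and sign: "\<And>p x. 0 < x \<Longrightarrow> 0 \<le> (- 1) ^ p * D p x"
    and zero: "\<And>y. b < y \<Longrightarrow> D 0 y = 0"
    and "0 < b" "3 / 4 * b < x"
  shows "D 0 x = 0"
proof (cases "b < x")
  case True
  then show ?thesis
    by (rule zero)
next
  case False
  \<comment> \<open>The midpoint of \<open>b\<close> and \<open>4 / 3 * x\<close>: it lies in the
    zero half-line, and still \<open>z - x < x / 3\<close>.\<close>
  define z where "z = (b + 4 / 3 * x) / 2"
  have x: "0 < x" and z: "b < z" "z < 4 / 3 * x" "x < z"
    using assms(4,5) False by (auto simp: z_def)
  \<comment> \<open>Radius \<open>(z - b) / 2\<close> keeps the left point of the derivative bound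
    above \<open>b\<close>, where \<open>D 0\<close> vanishes.\<close>
  have derivs_zero: "D p z = 0" for p
  proof -
    have "(- 1) ^ p * D p z * ((z - b) / 2) ^ p / fact p \<le> D 0 (z - (z - b) / 2)"
      using z \<open>0 < b\<close> by (intro completely_monotone_derivative_bound[OF D sign]) (auto simp: field_simps)
    also have "\<dots> = 0"
      using z by (intro zero) (auto simp: field_simps)
    finally have "(- 1) ^ p * D p z * (((z - b) / 2) ^ p / fact p) \<le> 0 * (((z - b) / 2) ^ p / fact p)"
      by simp
    then have "(- 1) ^ p * D p z \<le> 0"
      by (rule mult_right_le_imp_le) (use z in simp)
    then have "(- 1) ^ p * D p z = 0"
      using sign[of z p] z x by linarith
    then show ?thesis
      by simp
  qed
  \<comment> \<open>Only the Taylor remainder at some \<open>t\<close> in \<open>(x, z)\<close>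
    survives. The radius \<open>t - x / 2\<close> makes the left point \<open>x / 2\<close>
    independent of \<open>t\<close> and \<open>p\<close>; the ratio \<open>2 / 3\<close> comes from
    \<open>z - x < x / 3\<close> and \<open>t - x / 2 > x / 2\<close>.\<close>
  have bound: "D 0 x \<le> D 0 (x / 2) * (2 / 3) ^ p" if "0 < p" for p
  proof -
    have "\<exists>t. x < t \<and> t < z \<and> D 0 x = (\<Sum>m<p. D m z / fact m * (x - z) ^ m) + D p t / fact p * (x - z) ^ p"
      using x z that by (intro Taylor_down[where b = z]) (auto intro: D)
    then obtain t where t: "x < t" "t < z" "D 0 x = D p t / fact p * (x - z) ^ p"
      by (auto simp: derivs_zero)
    have "x - z = - (z - x)"
      by simp
    then have "D 0 x = (- 1) ^ p * D p t * (z - x) ^ p / fact p"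
      using t(3) power_minus[of "z - x" p] by (simp only: times_divide_eq_left times_divide_eq_right mult_ac)
    also have "\<dots> \<le> (- 1) ^ p * D p t * ((2 / 3) * (t - x / 2)) ^ p / fact p"
      using sign[of t p] x z t
      by (intro divide_right_mono mult_left_mono power_mono) (auto simp: field_simps)
    also have "\<dots> = ((- 1) ^ p * D p t * (t - x / 2) ^ p / fact p) * (2 / 3) ^ p"
      unfolding power_mult_distrib by simp
    also have "\<dots> \<le> D 0 (t - (t - x / 2)) * (2 / 3) ^ p"
      using x t by (intro mult_right_mono completely_monotone_derivative_bound[OF D sign]) auto
    finally show ?thesis
      by simp
  qed
  have "(\<lambda>p. D 0 (x / 2) * (2 / 3) ^ p) \<longlonglongrightarrow> D 0 (x / 2) * 0"
    by (intro tendsto_intros LIMSEQ_realpow_zero) auto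
  then have "D 0 x \<le> 0"
    using bound by (intro tendsto_lowerbound[of "\<lambda>p. D 0 (x / 2) * (2 / 3) ^ p" _ sequentially])
      (auto intro: eventually_sequentiallyI[of 1])
  then show ?thesis
    using sign[OF x, of 0] by simp
qed

text \<open>Monotonicity and nonnegativity carry the zero at \<open>b\<close> to the right. To the
  left, the zero half-line grows by the factor \<open>3 / 4\<close> repeatedly, and
  \<open>b * (3 / 4) ^ n\<close> falls below any positive \<open>x\<close>.\<close>

lemma completely_monotone_eq_0:
  fixes D :: "nat \<Rightarrow> real \<Rightarrow> real"
  assumes D: "\<And>p x. 0 < x \<Longrightarrow> (D p has_field_derivative D (Suc p) x) (at x)"
    and sign: "\<And>p x. 0 < x \<Longrightarrow> 0 \<le> (- 1) ^ p * D p x"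
    and "0 < b" "D 0 b = 0" "0 < x"
  shows "D 0 x = 0"
proof -
  have right: "D 0 y = 0" if "b < y" for y
  proof -
    have "D 0 y \<le> D 0 b"
    proof (rule DERIV_nonpos_imp_nonincreasing[where f = "D 0"])
      fix u assume "b \<le> u" "u \<le> y"
      then have "0 < u"
        using \<open>0 < b\<close> by simp
      then show "\<exists>v. (D 0 has_real_derivative v) (at u) \<and> v \<le> 0"
        using D[of u 0] sign[of u 1] by auto
    qed (use that in simp)
    moreover have "0 \<le> D 0 y"
      using sign[of y 0] that \<open>0 < b\<close> by simp
    ultimately show ?thesis
      using \<open>D 0 b = 0\<close> by simp
  qed
  have "\<forall>y > b * (3 / 4) ^ n. D 0 y = 0" for n
  proof (induction n)
    case 0
    then show ?case
      using right by simp
  next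
    case (Suc n)
    show ?case
    proof (intro allI impI)
      fix y assume "b * (3 / 4) ^ Suc n < y"
      then have "3 / 4 * (b * (3 / 4) ^ n) < y"
        by simp
      with Suc.IH \<open>0 < b\<close> show "D 0 y = 0"
        using completely_monotone_zero_extends_left[OF D sign, of "b * (3 / 4) ^ n" y] by simp
    qed
  qed
  moreover obtain n where "(3 / 4) ^ n < x / b"
    using real_arch_pow_inv[of "x / b" "3 / 4"] \<open>0 < b\<close> \<open>0 < x\<close> by auto
  then have "b * (3 / 4) ^ n < x"
    using \<open>0 < b\<close> by (simp add: field_simps)
  ultimately show ?thesis
    by blast
qed

text \<open>The negated derivative of a completely monotone function is again completely monotone,
  so \<open>completely_monotone_eq_0\<close> applies to it.\<close>

lemma completely_monotone_on_deriv_eq_0: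
  assumes F: "completely_monotone_on {0<..} F" and "0 < b" "deriv F b = 0" "0 < x"
  shows "deriv F x = 0"
proof -
  define D where "D p = (\<lambda>x. - (deriv ^^ Suc p) F x)" for p
  have D: "(D p has_field_derivative D (Suc p) x) (at x)" if "0 < x" for p x
  proof -
    have "(deriv ^^ Suc p) F differentiable at x"
      using F that unfolding completely_monotone_on_def by blast
    then have "((deriv ^^ Suc p) F has_field_derivative deriv ((deriv ^^ Suc p) F) x) (at x)"
      by (simp add: DERIV_deriv_iff_real_differentiable)
    from DERIV_minus[OF this] show ?thesis
      by (simp add: D_def)
  qed
  have sign: "0 \<le> (- 1) ^ p * D p x" if "0 < x" for p x
  proof -
    have "0 \<le> (- 1) ^ Suc p * (deriv ^^ Suc p) F x"
      using F that unfolding completely_monotone_on_def by blast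
    then show ?thesis
      by (simp add: D_def)
  qed
  have "D 0 b = 0"
    using assms by (simp add: D_def)
  then have "D 0 x = 0"
    using completely_monotone_eq_0[OF D sign \<open>0 < b\<close> _ \<open>0 < x\<close>] by blast
  then show ?thesis
    by (simp add: D_def)
qed

section \<open>Laplace transforms\<close>

text \<open>
  Convexity of \<open>x \<mapsto> exp (- x t)\<close> bounds the slope of the transform on \<open>(0, b)\<close> above by the
  negative of \<open>\<integral> t exp (- b t) d\<mu>(t)\<close>, so a vanishing slope at \<open>b\<close> forces \<open>\<mu>\<close> to live at \<open>0\<close>.
\<close>

lemma laplace_transform_constant:
  fixes \<mu> :: "real measure" and G g :: "real \<Rightarrow> real"
  assumes sets: "sets \<mu> = sets (restrict_space borel {0..})"
    and int: "\<And>x. 0 < x \<Longrightarrow> x < b \<Longrightarrow> integrable \<mu> (\<lambda>t. exp (- (x * t)))"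
    and G: "\<And>x. 0 < x \<Longrightarrow> x < b \<Longrightarrow> G x = (LINT t|\<mu>. exp (- (x * t)))"
    and g: "\<And>x. 0 < x \<Longrightarrow> x < b \<Longrightarrow> (G has_field_derivative g x) (at x)"
    and lim: "(g \<longlongrightarrow> 0) (at_left b)"
    and x: "0 < x" "x < b" and y: "0 < y" "y < b"
  shows "G x = G y"
proof -
  have "space \<mu> = {0..}"
    using sets_eq_imp_space_eq[OF sets] by (simp add: space_restrict_space)
  then have nonneg: "0 \<le> t" if "t \<in> space \<mu>" for t
    using that by simp
  have meas: "f \<in> borel_measurable \<mu>" if "f \<in> borel_measurable borel" for f :: "real \<Rightarrow> real"
    using that measurable_cong_sets[OF sets refl] measurable_restrict_space1 by blast
  define k where "k = (\<lambda>t. t * exp (- (b * t)))"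
  \<comment> \<open>Integrability is known only strictly below \<open>b\<close>. The kernel at an
    interior \<open>x\<close> dominates, because
    \<open>(b - x) * t \<le> exp ((b - x) * t)\<close>.\<close>
  have k_int: "integrable \<mu> k"
  proof (rule Bochner_Integration.integrable_bound)
    show "integrable \<mu> (\<lambda>t. exp (- (x * t)) / (b - x))"
      using int[OF x] by simp
    show "k \<in> borel_measurable \<mu>"
      unfolding k_def by (rule meas) simp
    show "AE t in \<mu>. norm (k t) \<le> norm (exp (- (x * t)) / (b - x))"
    proof (rule AE_I2)
      fix t assume "t \<in> space \<mu>"
      then have t: "0 \<le> t"
        by (rule nonneg)
      have "(b - x) * t \<le> exp ((b - x) * t)"
        using exp_ge_add_one_self[of "(b - x) * t"] by linarith
      then have "(b - x) * t * exp (- (b * t)) \<le> exp ((b - x) * t) * exp (- (b * t))"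
        by (intro mult_right_mono) auto
      also have "\<dots> = exp (- (x * t))"
        by (simp add: exp_add[symmetric] algebra_simps)
      finally show "norm (k t) \<le> norm (exp (- (x * t)) / (b - x))"
        using t x by (simp add: k_def abs_mult field_simps)
    qed
  qed
  have k_nonneg: "AE t in \<mu>. 0 \<le> k t"
    by (rule AE_I2) (simp add: k_def nonneg)
  have slope: "(LINT t|\<mu>. k t) \<le> - g u" if u: "0 < u" "u < b" for u
  proof -
    \<comment> \<open>Chord version of the slope bound; letting \<open>v\<close> decrease to
      \<open>u\<close> gives the derivative.\<close>
    have "(LINT t|\<mu>. k t) \<le> - ((G v - G u) / (v - u))" if v: "u < v" "v < b" for v
    proof -
      have "(v - u) * (LINT t|\<mu>. k t) = (LINT t|\<mu>. (v - u) * k t)"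
        by simp
      also have "\<dots> \<le> (LINT t|\<mu>. exp (- (u * t)) - exp (- (v * t)))"
      proof (rule integral_mono)
        show "integrable \<mu> (\<lambda>t. (v - u) * k t)"
          using k_int by simp
        show "integrable \<mu> (\<lambda>t. exp (- (u * t)) - exp (- (v * t)))"
          using u v by (intro Bochner_Integration.integrable_diff int) auto
        fix t assume "t \<in> space \<mu>"
        then have t: "0 \<le> t"
          by (rule nonneg)
        have "(v - u) * t * exp (- (b * t)) \<le> (v - u) * t * exp (- (v * t))"
          using t v by (intro mult_left_mono) (auto simp: mult_right_mono)
        also have "\<dots> \<le> (exp ((v - u) * t) - 1) * exp (- (v * t))"
          using exp_ge_add_one_self[of "(v - u) * t"] by (intro mult_right_mono exp_ge_zero) linarith
        also have "\<dots> = exp (- (u * t)) - exp (- (v * t))"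
          by (simp add: left_diff_distrib exp_add[symmetric] algebra_simps)
        finally show "(v - u) * k t \<le> exp (- (u * t)) - exp (- (v * t))"
          by (simp add: k_def mult.assoc)
      qed
      also have "\<dots> = G u - G v"
        using u v by (simp add: G int)
      finally show ?thesis
        using v by (simp add: field_simps)
    qed
    moreover have "((\<lambda>v. - ((G v - G u) / (v - u))) \<longlongrightarrow> - g u) (at_right u)"
      using g[OF u] unfolding has_field_derivative_iff
      by (intro tendsto_minus) (rule filterlim_mono[OF _ order_refl at_le], auto)
    moreover have "\<forall>\<^sub>F v in at_right u. u < v \<and> v < b"
      using u by (auto simp: eventually_at_right)
    ultimately show ?thesis
      by (intro tendsto_lowerbound) (auto elim: eventually_mono)
  qed
  have "\<forall>\<^sub>F u in at_left b. (LINT t|\<mu>. k t) \<le> - g u"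
    using x by (auto simp: eventually_at_left intro!: exI[of _ 0] slope)
  then have "(LINT t|\<mu>. k t) \<le> - 0"
    by (intro tendsto_lowerbound[OF tendsto_minus[OF lim]]) auto
  moreover have "0 \<le> (LINT t|\<mu>. k t)"
    using k_nonneg by (rule integral_nonneg_AE)
  ultimately have "AE t in \<mu>. k t = 0"
    using integral_nonneg_eq_0_iff_AE[OF k_int k_nonneg] by simp
  \<comment> \<open>\<open>k t = 0\<close> means \<open>t = 0\<close>, where both exponentials equal
    \<open>1\<close>.\<close>
  then have "AE t in \<mu>. exp (- (x * t)) = exp (- (y * t))"
    by eventually_elim (simp add: k_def)
  then have "(LINT t|\<mu>. exp (- (x * t))) = (LINT t|\<mu>. exp (- (y * t)))"
    by (intro integral_cong_AE meas) auto
  then show ?thesis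
    using x y by (simp add: G)
qed

section \<open>The Green function\<close>

definition symbol_inverse :: "real \<Rightarrow> real \<Rightarrow> nat \<Rightarrow> real" where
  "symbol_inverse \<alpha> c n = 1 / (c + real n powr \<alpha>)"

text \<open>The second difference centred at \<open>n + 1\<close>, hence the coefficient that goes
  with frequency \<open>Suc n\<close>.\<close>

definition green_diff :: "real \<Rightarrow> real \<Rightarrow> nat \<Rightarrow> real" where
  "green_diff \<alpha> c n =
     symbol_inverse \<alpha> c (n + 2) - 2 * symbol_inverse \<alpha> c (n + 1) + symbol_inverse \<alpha> c n"

lemma green_partial_sum_eq:
  "green_partial_sum \<alpha> c N x = 1 / (2 * pi) *
     (symbol_inverse \<alpha> c 0 + 2 * (\<Sum>n<N. symbol_inverse \<alpha> c (Suc n) * cos (real (Suc n) * x)))"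
proof (induction N)
  case 0
  then show ?case
    by (simp add: green_partial_sum_def symbol_inverse_def)
next
  case (Suc N)
  let ?t = "\<lambda>n. cos (real_of_int n * x) / (c + \<bar>real_of_int n\<bar> powr \<alpha>)"
  have "{- int (Suc N)..int (Suc N)} = insert (- int (Suc N)) (insert (int (Suc N)) {- int N..int N})"
    by auto
  then have "sum ?t {- int (Suc N)..int (Suc N)} = ?t (- int (Suc N)) + (?t (int (Suc N)) + sum ?t {- int N..int N})"
    by simp
  moreover have "?t (int (Suc N)) = symbol_inverse \<alpha> c (Suc N) * cos (real (Suc N) * x)"
    "?t (- int (Suc N)) = symbol_inverse \<alpha> c (Suc N) * cos (real (Suc N) * x)"
    unfolding of_int_minus of_int_of_nat_eq mult_minus_left cos_minus abs_minus_cancel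
    by (simp_all add: symbol_inverse_def)
  ultimately have "green_partial_sum \<alpha> c (Suc N) x = green_partial_sum \<alpha> c N x
     + 1 / (2 * pi) * (2 * (symbol_inverse \<alpha> c (Suc N) * cos (real (Suc N) * x)))"
    unfolding green_partial_sum_def by (simp only: distrib_left mult_2)
  then show ?case
    unfolding Suc.IH sum.lessThan_Suc by (simp only: distrib_left add.assoc)
qed

lemma symbol_inverse_tendsto_0:
  assumes "0 < \<alpha>" "0 < c"
  shows "symbol_inverse \<alpha> c \<longlonglongrightarrow> 0"
proof -
  have "filterlim (\<lambda>n. c + real n powr \<alpha>) at_top sequentially"
    using assms by (intro filterlim_tendsto_add_at_top[OF tendsto_const]
       filterlim_compose[OF real_powr_at_top filterlim_real_sequentially])
  then show ?thesis
    unfolding symbol_inverse_def by (intro tendsto_divide_0[OF tendsto_const] filterlim_at_top_imp_at_infinity)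
qed

lemma summable_green_diff:
  assumes "0 < \<alpha>" "0 < c"
  shows "summable (\<lambda>n. real (Suc n) * \<bar>green_diff \<alpha> c n\<bar>)"
  using summable_symbol_second_difference[OF assms] by (simp add: green_diff_def symbol_inverse_def)

lemma cos_neq_1:
  assumes "0 < x" "x < pi"
  shows "cos x \<noteq> 1"
  using cos_monotone_0_pi[of 0 x] assms by simp

lemma green_partial_sum_tendsto:
  assumes "0 < \<alpha>" "0 < c" "cos x \<noteq> 1"
  shows "(\<lambda>N. green_partial_sum \<alpha> c N x) \<longlonglongrightarrow>
    (symbol_inverse \<alpha> c 1 - symbol_inverse \<alpha> c 0 + (\<Sum>n. green_diff \<alpha> c n * cos (real (Suc n) * x)))
      / (2 * pi * (cos x - 1))"
proof -
  have "(\<lambda>N. 1 / (2 * pi) *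
     (symbol_inverse \<alpha> c 0 + 2 * (\<Sum>n<N. symbol_inverse \<alpha> c (Suc n) * cos (real (Suc n) * x)))) \<longlonglongrightarrow>
    1 / (2 * pi) *
      ((symbol_inverse \<alpha> c 1 - symbol_inverse \<alpha> c 0 + (\<Sum>n. green_diff \<alpha> c n * cos (real (Suc n) * x)))
      / (cos x - 1))"
    using cos_sum_tendsto[OF symbol_inverse_tendsto_0[OF assms(1,2)], folded green_diff_def,
        OF summable_of_summable_Suc_mult[OF summable_green_diff[OF assms(1,2)]] assms(3)]
    by (rule tendsto_mult[OF tendsto_const])
  then show ?thesis
    unfolding green_partial_sum_eq by simp
qed

lemma green_eq:
  assumes "0 < \<alpha>" "0 < c" "cos x \<noteq> 1"
  shows "green \<alpha> c x =
    (symbol_inverse \<alpha> c 1 - symbol_inverse \<alpha> c 0 + (\<Sum>n. green_diff \<alpha> c n * cos (real (Suc n) * x)))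
      / (2 * pi * (cos x - 1))"
  unfolding green_def by (rule limI[OF green_partial_sum_tendsto[OF assms]])

lemma eventually_cos_neq_1:
  fixes x :: real
  assumes "cos x \<noteq> 1"
  shows "\<forall>\<^sub>F y in nhds x. cos y \<noteq> 1"
proof -
  have "open (cos -` (- {1 :: real}))"
    by (intro continuous_open_vimage) (auto intro: continuous_intros)
  then show ?thesis
    unfolding eventually_nhds using assms by (intro exI[of _ "cos -` (- {1})"]) auto
qed

text \<open>
  The formula in \<open>green_eq\<close> is periodic and remains smooth across \<open>\<pi>\<close>, where every sine in
  the numerator of the derivative vanishes.
\<close>

lemma green_has_continuous_derivative:
  assumes "0 < \<alpha>" "0 < c"
  obtains g where "\<And>x. cos x \<noteq> 1 \<Longrightarrow> (green \<alpha> c has_field_derivative g x) (at x)"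
    and "isCont g pi" "g pi = 0"
proof -
  let ?e = "green_diff \<alpha> c"
  define A where "A = symbol_inverse \<alpha> c 1 - symbol_inverse \<alpha> c 0"
  define K where "K x = (\<Sum>n. ?e n * cos (real (Suc n) * x))" for x
  define K' where "K' x = (\<Sum>n. - (real (Suc n) * ?e n) * sin (real (Suc n) * x))" for x
  \<comment> \<open>The quotient rule for \<open>(A + K x) / (2 * pi * (cos x - 1))\<close>.\<close>
  define g where "g x = (K' x * (2 * pi * (cos x - 1)) + (A + K x) * (2 * pi * sin x)) / (2 * pi * (cos x - 1))\<^sup>2" for x
  note sm = summable_green_diff[OF assms]
  have K': "(K has_field_derivative K' x) (at x)" for x
    unfolding K_def K'_def by (rule has_field_derivative_cos_series[OF sm])
  have "(green \<alpha> c has_field_derivative g x) (at x)" if x: "cos x \<noteq> 1" for x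
  proof -
    have "((\<lambda>x. (A + K x) / (2 * pi * (cos x - 1))) has_field_derivative g x) (at x)"
      using x unfolding g_def by (auto intro!: derivative_eq_intros K' simp: power2_eq_square)
    moreover have "\<forall>\<^sub>F y in nhds x. green \<alpha> c y = (A + K y) / (2 * pi * (cos y - 1))"
      using eventually_cos_neq_1[OF x] by eventually_elim (simp add: green_eq assms A_def K_def)
    ultimately show ?thesis
      by (simp add: DERIV_cong_ev[OF refl _ refl])
  qed
  moreover have "isCont g pi"
  proof -
    have "isCont K' pi"
      using continuous_sin_series[of "\<lambda>n. - (real (Suc n) * ?e n)"] sm
      unfolding K'_def by (simp add: abs_mult continuous_on_eq_continuous_at)
    moreover have "isCont K pi"
      using K' DERIV_isCont by blast
    ultimately show ?thesis
      unfolding g_def by (intro continuous_intros) auto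
  qed
  moreover have "g pi = 0"
    by (simp add: g_def K'_def sin_npi[of "Suc n" for n, simplified])
  ultimately show thesis
    by (rule that)
qed

text \<open>A constant value would make the cosine series in \<open>green_eq\<close> affine in
  \<open>cos x\<close>. Then \<open>green_diff\<close> vanishes from index \<open>1\<close> on,
  which forces the positive number \<open>symbol_inverse \<alpha> c 1\<close> to be
  \<open>0\<close>.\<close>

lemma green_not_constant:
  assumes "0 < \<alpha>" "0 < c"
  shows "\<not> (\<forall>x\<in>{0<..<pi}. green \<alpha> c x = k)"
proof
  assume k: "\<forall>x\<in>{0<..<pi}. green \<alpha> c x = k"
  have "green_diff \<alpha> c n = 0" if "0 < n" for n
  proof (rule cos_series_eq_affine_cos_imp[OF _ _ that])
    show "summable (\<lambda>n. \<bar>green_diff \<alpha> c n\<bar>)"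
      by (rule summable_of_summable_Suc_mult[OF summable_green_diff[OF assms]])
    fix x assume x: "0 < x" "x < pi"
    then have "cos x \<noteq> 1"
      by (rule cos_neq_1)
    with green_eq[OF assms this] k x
    show "(\<Sum>n. green_diff \<alpha> c n * cos (real (Suc n) * x)) =
       (2 * pi * k) * cos x + (symbol_inverse \<alpha> c 0 - symbol_inverse \<alpha> c 1 - 2 * pi * k)"
      by (simp add: field_simps)
  qed
  then have "symbol_inverse \<alpha> c 1 = 0"
    using eventually_affine_null_sequence[OF symbol_inverse_tendsto_0[OF assms]]
    by (simp add: green_diff_def)
  then show False
    using assms by (simp add: symbol_inverse_def)
qed

section \<open>Boundary derivative at \<open>pi\<close> and the two impossibility results\<close>

theorem mainTheorem2:
  fixes \<alpha> c :: real
  assumes "0 < \<alpha>" and "\<alpha> \<le> 2" and "0 < c"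
  shows "(\<forall>x\<in>{0<..<pi}. convergent (\<lambda>N. green_partial_sum \<alpha> c N x)) \<and>
    (\<forall>x\<in>{0<..<pi}. green \<alpha> c differentiable at x) \<and>
    (deriv (green \<alpha> c) \<longlongrightarrow> 0) (at_left pi) \<and>
    \<not> (\<exists>\<mu>. radon_measure_on {0..} \<mu> \<and>
          (\<forall>x\<in>{0<..<pi}. integrable \<mu> (\<lambda>t. exp (- (x * t))) \<and>
             green \<alpha> c x = (LINT t|\<mu>. exp (- (x * t))))) \<and>
    \<not> (\<exists>F. (\<forall>x\<in>{0<..<pi}. F x = green \<alpha> c x) \<and> completely_monotone_on {0<..} F)"
proof -
  let ?G = "green \<alpha> c"
  obtain g where g: "\<And>x. cos x \<noteq> 1 \<Longrightarrow> (?G has_field_derivative g x) (at x)"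
    and g_cont: "isCont g pi" and g_pi: "g pi = 0"
    using green_has_continuous_derivative[OF assms(1,3)] by blast
  have G': "(?G has_field_derivative g x) (at x)" if "0 < x" "x < pi" for x
    using g cos_neq_1[OF that] .
  have g_lim: "(g \<longlongrightarrow> 0) (at_left pi)"
    using isContD[OF g_cont] g_pi filterlim_at_split by fastforce
  have near_pi: "\<forall>\<^sub>F x in at_left pi. 0 < x \<and> x < pi"
    unfolding eventually_at_left[OF pi_gt_zero] using pi_gt_zero by blast
  \<comment> \<open>Both impossibility claims end here; \<open>1\<close> serves as a reference point
    of \<open>(0, pi)\<close>.\<close>
  have not_constant: False if "\<And>x. 0 < x \<Longrightarrow> x < pi \<Longrightarrow> ?G x = ?G 1"
    using green_not_constant[OF assms(1,3), of "?G 1"] that by simp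
  have "convergent (\<lambda>N. green_partial_sum \<alpha> c N x)" if "x \<in> {0<..<pi}" for x
    using green_partial_sum_tendsto[OF assms(1,3) cos_neq_1] that convergentI by auto
  moreover have "?G differentiable at x" if "x \<in> {0<..<pi}" for x
    using G'[of x] that by (auto simp: real_differentiable_def)
  moreover have "(deriv ?G \<longlongrightarrow> 0) (at_left pi)"
    using near_pi by (intro Lim_transform_eventually[OF g_lim]) (auto elim!: eventually_mono simp: DERIV_imp_deriv[OF G'])
  moreover have False if "radon_measure_on {0..} \<mu>"
    and \<mu>: "\<forall>x\<in>{0<..<pi}. integrable \<mu> (\<lambda>t. exp (- (x * t))) \<and> ?G x = (LINT t|\<mu>. exp (- (x * t)))" for \<mu>
  proof (rule not_constant)
    fix x :: real
    assume x: "0 < x" "x < pi"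
    have sets: "sets \<mu> = sets (restrict_space borel {0..})"
      using that(1) by (simp add: radon_measure_on_def)
    show "?G x = ?G 1"
      by (rule laplace_transform_constant[OF sets _ _ G' g_lim x]) (use \<mu> pi_gt3 in auto)
  qed
  moreover have False if F: "\<forall>x\<in>{0<..<pi}. F x = ?G x" and cm: "completely_monotone_on {0<..} F" for F
  proof (rule not_constant)
    have F_g: "deriv F x = g x" if x: "0 < x" "x < pi" for x
    proof -
      have "\<forall>\<^sub>F y in nhds x. F y = ?G y"
        using eventually_nhds_in_open[of "{0<..<pi}" x] x F by (auto elim: eventually_mono)
      then have "(F has_field_derivative g x) (at x)"
        using G'[OF x] by (simp add: DERIV_cong_ev[OF refl _ refl])
      then show ?thesis
        by (rule DERIV_imp_deriv)
    qed
    \<comment> \<open>\<open>F\<close> agrees with the Green function only to the left of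
      \<open>pi\<close>. Continuity of \<open>deriv F\<close> at \<open>pi\<close> identifies
      \<open>deriv F pi\<close> with the left limit \<open>0\<close>.\<close>
    have "(deriv ^^ 1) F differentiable at pi"
      using cm pi_gt_zero unfolding completely_monotone_on_def by blast
    then have "isCont (deriv F) pi"
      by (simp add: differentiable_imp_continuous_within)
    then have "(deriv F \<longlongrightarrow> deriv F pi) (at_left pi)"
      using isContD filterlim_at_split by blast
    moreover have "(deriv F \<longlongrightarrow> 0) (at_left pi)"
      using near_pi by (intro Lim_transform_eventually[OF g_lim]) (auto elim!: eventually_mono simp: F_g)
    ultimately have "deriv F pi = 0"
      using tendsto_unique trivial_limit_at_left_real by blast
    then have "g x = 0" if "0 < x" "x < pi" for x
      using completely_monotone_on_deriv_eq_0[OF cm pi_gt_zero] F_g that by simp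
    then have G0: "(?G has_field_derivative 0) (at x)" if "0 < x" "x < pi" for x
      using G'[OF that] that by simp
    fix x :: real
    assume x: "0 < x" "x < pi"
    have "\<exists>k. \<forall>y\<in>{0<..<pi}. ?G y = k"
      by (rule has_field_derivative_zero_constant) (simp_all add: has_field_derivative_at_within G0)
    then obtain k where "\<forall>y\<in>{0<..<pi}. ?G y = k"
      by blast
    then show "?G x = ?G 1"
      using x pi_gt3 by simp
  qed
  ultimately show ?thesis
    by blast
qed

end
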